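(* Let $d\ge 4$, let $\Sigma\subseteq\mathbb{C}^d$ be an even-dimensional subspace with $\dim\Sigma\ge 4$ (possibly $\Sigma=\mathbb{C}^d$ when $d$ is even), and let $U$ be an antisymmetric operator on $\mathbb{C}^d$ that is unitary on $\Sigma$ and zero on $\Sigma^\perp$. For $(x,y)\in[0,1]\times[0,1]$ let $\chi^U_{x,y}:M_d\to M_d$ be the positive map $$\chi^U_{x,y}(X)=\mathrm{Tr}(X)\,\mathbb{I}_d - yX - x\,UX^TU^*.$$ If $x+y>3/2$, then $\chi^U_{x,y}$ is indecomposable.
   Context: $M_d$ is the algebra of $d\times d$ complex matrices (operators on $\mathbb{C}^d$), $\mathbb{I}_d$ the identity, $X^*$ the adjoint. Transposition $X\mapsto X^T$ is taken with respect to an orthonormal basis $(e_1,\dots,e_d)$ of $\mathbb{C}^d$ such that $\Sigma=\mathrm{span}(e_1,\dots,e_{2k})$, where $2k=\dim\Sigma$. "$U$ is antisymmetric, unitary on $\Sigma$ and zero on $\Sigma^\perp$" means: $U$ maps $\Sigma$ unitarily onto $\Sigma$, $U|_{\Sigma^\perp}=0$, and $U^T=-U$. A linear map $\varphi:M_d\to M_d$ is positive if it maps positive semidefinite matrices to positive semidefinite matrices; it is completely copositive if $\varphi\circ\tau$ is completely positive, where $\tau(X)=X^T$. A positive map is decomposable if it is the sum of a completely positive map and a completely copositive map; otherwise it is indecomposable. *)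

theory Defs
  imports "HOL-Analysis.Analysis"
begin

text \<open>The library's inner product on \<open>complex ^ 'd\<close> is the real one; this is the Hermitian
  form, antilinear in the first argument.\<close>

definition cinner :: "complex ^ 'd \<Rightarrow> complex ^ 'd \<Rightarrow> complex" where
  "cinner v w = (\<Sum>a\<in>UNIV. cnj (v $ a) * w $ a)"

definition adjoint_mat :: "complex ^ 'd ^ 'd \<Rightarrow> complex ^ 'd ^ 'd" where
  "adjoint_mat A = (\<chi> a b. cnj (A $ b $ a))"

definition ketbra :: "complex ^ 'd \<Rightarrow> complex ^ 'd \<Rightarrow> complex ^ 'd ^ 'd" where
  "ketbra v w = (\<chi> a b. v $ a * cnj (w $ b))"

definition orthonormal_basis :: "(nat \<Rightarrow> complex ^ 'd) \<Rightarrow> bool" where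
  "orthonormal_basis e \<longleftrightarrow>
     (\<forall>i<CARD('d). \<forall>j<CARD('d). cinner (e i) (e j) = (if i = j then 1 else 0)) \<and>
     vec.span (e ` {..<CARD('d)}) = UNIV"

text \<open>If \<open>X\<close> has entries \<open>x i j = cinner (e i) (X *v e j)\<close> in the orthonormal basis \<open>e\<close>, i.e.
  \<open>X = (\<Sum>i j. x i j * |e i><e j|)\<close>, its transpose with respect to \<open>e\<close> is
  \<open>(\<Sum>i j. x i j * |e j><e i|)\<close>. Scalar multiples of matrices are written \<open>mat c ** A\<close>.\<close>

definition transpose_wrt :: "(nat \<Rightarrow> complex ^ 'd) \<Rightarrow> complex ^ 'd ^ 'd \<Rightarrow> complex ^ 'd ^ 'd" where
  "transpose_wrt e X =
     (\<Sum>i<CARD('d). \<Sum>j<CARD('d). mat (cinner (e i) (X *v e j)) ** ketbra (e j) (e i))"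

definition unitary_on :: "(complex ^ 'd) set \<Rightarrow> complex ^ 'd ^ 'd \<Rightarrow> bool" where
  "unitary_on S U \<longleftrightarrow>
     (\<lambda>v. U *v v) ` S = S \<and> (\<forall>v\<in>S. \<forall>w\<in>S. cinner (U *v v) (U *v w) = cinner v w)"

definition zero_on_orthogonal_complement :: "(complex ^ 'd) set \<Rightarrow> complex ^ 'd ^ 'd \<Rightarrow> bool" where
  "zero_on_orthogonal_complement S U \<longleftrightarrow> (\<forall>v. (\<forall>w\<in>S. cinner w v = 0) \<longrightarrow> U *v v = 0)"

definition psd :: "complex ^ 'd ^ 'd \<Rightarrow> bool" where
  "psd A \<longleftrightarrow> (\<forall>v. cinner v (A *v v) \<in> \<real>\<^sub>\<ge>\<^sub>0)"

text \<open>Positive semidefiniteness of the \<open>n \<times> n\<close> block matrix with blocks \<open>B i j\<close>,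
  \<open>i, j < n\<close>, acting on the \<open>n\<close>-fold direct sum of \<open>complex ^ 'd\<close>.\<close>

definition psd_block :: "nat \<Rightarrow> (nat \<Rightarrow> nat \<Rightarrow> complex ^ 'd ^ 'd) \<Rightarrow> bool" where
  "psd_block n B \<longleftrightarrow>
     (\<forall>v :: nat \<Rightarrow> complex ^ 'd. (\<Sum>i<n. \<Sum>j<n. cinner (v i) (B i j *v v j)) \<in> \<real>\<^sub>\<ge>\<^sub>0)"

definition complex_linear_map :: "(complex ^ 'd ^ 'd \<Rightarrow> complex ^ 'd ^ 'd) \<Rightarrow> bool" where
  "complex_linear_map \<phi> \<longleftrightarrow>
     (\<forall>X Y. \<phi> (X + Y) = \<phi> X + \<phi> Y) \<and> (\<forall>c X. \<phi> (mat c ** X) = mat c ** \<phi> X)"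

definition positive_map :: "(complex ^ 'd ^ 'd \<Rightarrow> complex ^ 'd ^ 'd) \<Rightarrow> bool" where
  "positive_map \<phi> \<longleftrightarrow> complex_linear_map \<phi> \<and> (\<forall>X. psd X \<longrightarrow> psd (\<phi> X))"

text \<open>All amplifications of \<open>\<phi>\<close> to block matrices preserve positive semidefiniteness.\<close>

definition completely_positive :: "(complex ^ 'd ^ 'd \<Rightarrow> complex ^ 'd ^ 'd) \<Rightarrow> bool" where
  "completely_positive \<phi> \<longleftrightarrow>
     complex_linear_map \<phi> \<and> (\<forall>n B. psd_block n B \<longrightarrow> psd_block n (\<lambda>i j. \<phi> (B i j)))"

definition completely_copositive ::
    "(nat \<Rightarrow> complex ^ 'd) \<Rightarrow> (complex ^ 'd ^ 'd \<Rightarrow> complex ^ 'd ^ 'd) \<Rightarrow> bool" where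
  "completely_copositive e \<phi> \<longleftrightarrow>
     complex_linear_map \<phi> \<and> completely_positive (\<phi> \<circ> transpose_wrt e)"

definition decomposable ::
    "(nat \<Rightarrow> complex ^ 'd) \<Rightarrow> (complex ^ 'd ^ 'd \<Rightarrow> complex ^ 'd ^ 'd) \<Rightarrow> bool" where
  "decomposable e \<phi> \<longleftrightarrow>
     (\<exists>\<phi>1 \<phi>2. completely_positive \<phi>1 \<and> completely_copositive e \<phi>2 \<and>
        (\<forall>X. \<phi> X = \<phi>1 X + \<phi>2 X))"

definition indecomposable ::
    "(nat \<Rightarrow> complex ^ 'd) \<Rightarrow> (complex ^ 'd ^ 'd \<Rightarrow> complex ^ 'd ^ 'd) \<Rightarrow> bool" where
  "indecomposable e \<phi> \<longleftrightarrow> positive_map \<phi> \<and> \<not> decomposable e \<phi>"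

definition chi_map ::
    "(nat \<Rightarrow> complex ^ 'd) \<Rightarrow> complex ^ 'd ^ 'd \<Rightarrow> real \<Rightarrow> real \<Rightarrow>
     complex ^ 'd ^ 'd \<Rightarrow> complex ^ 'd ^ 'd" where
  "chi_map e U x y X =
     mat (trace X) - y *\<^sub>R X - x *\<^sub>R (U ** transpose_wrt e X ** adjoint_mat U)"

end

theory Submission
  imports Defs
begin

text \<open>
  Positivity: \<open>\<langle>v, \<chi> X v\<rangle> = tr X \<parallel>v\<parallel>\<^sup>2 - y \<langle>v, X v\<rangle> - x \<langle>w, X w\<rangle>\<close> where \<open>w\<close> is the
  complex conjugate of \<open>U\<^sup>* v\<close>. Antisymmetry makes \<open>w\<close> orthogonal to \<open>v\<close>, and \<open>\<parallel>w\<parallel> \<le> \<parallel>v\<parallel>\<close>, so the two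
  subtracted terms are dominated by the trace.

  Indecomposability: let \<open>n\<close> be the dimension of the support of \<open>U\<close>, \<open>P\<close> its projection and \<open>g i\<close>
  the complex conjugate of \<open>U (e i)\<close>. The block matrix
  \<open>B i j = \<delta> i j P + |e i><e j| + |U (e j)><U (e i)|\<close> has blockwise transpose
  \<open>\<delta> i j P + |g i><g j| + |e j><e i|\<close>. Both are positive, so every decomposable \<open>\<phi>\<close> has
  \<open>(\<Sum>i j. \<langle>e i, \<phi> (B i j) (e j)\<rangle>) \<ge> 0\<close>. For \<open>\<chi>\<close> this sum is \<open>n (n + 2) - (x + y) n\<^sup>2\<close>, which is
  negative iff \<open>x + y > 1 + 2 / n\<close>; the right side is at most \<open>3 / 2\<close> for \<open>n \<ge> 4\<close>. Antisymmetry
  enters as \<open>(\<Sum>i j. \<langle>e i, U (e j)\<rangle> * \<langle>U (e i), e j\<rangle>) = - n\<close>.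
\<close>

section \<open>The Hermitian form, rank-one operators, adjoints and traces\<close>

lemma cinner_add_right: "cinner v (w + z) = cinner v w + cinner v z"
  by (simp add: cinner_def algebra_simps sum.distrib)

lemma cinner_diff_right: "cinner v (w - z) = cinner v w - cinner v z"
  by (simp add: cinner_def algebra_simps sum_subtractf)

lemma cinner_minus_right: "cinner v (- w) = - cinner v w"
  by (simp add: cinner_def sum_negf)

lemma cinner_add_left: "cinner (v + w) z = cinner v z + cinner w z"
  by (simp add: cinner_def algebra_simps sum.distrib)

lemma cinner_minus_left: "cinner (- v) w = - cinner v w"
  by (simp add: cinner_def sum_negf)

lemma cinner_diff_left: "cinner (v - w) z = cinner v z - cinner w z"
  by (simp add: cinner_def algebra_simps sum_subtractf)

lemma cinner_scale_right: "cinner v (c *s w) = c * cinner v w"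
  by (simp add: cinner_def sum_distrib_left algebra_simps)

lemma cinner_scale_left: "cinner (c *s v) w = cnj c * cinner v w"
  by (simp add: cinner_def sum_distrib_left algebra_simps)

lemma cinner_scaleR_right: "cinner v (r *\<^sub>R w) = of_real r * cinner v w"
  by (simp add: cinner_def sum_distrib_left scaleR_conv_of_real[where 'a = complex] algebra_simps)

lemma cinner_zero_right [simp]: "cinner v 0 = 0"
  by (simp add: cinner_def)

lemma cinner_zero_left [simp]: "cinner 0 v = 0"
  by (simp add: cinner_def)

lemma cinner_sum_right: "cinner v (sum f A) = (\<Sum>i\<in>A. cinner v (f i))"
  by (induction A rule: infinite_finite_induct) (auto simp: cinner_add_right)

lemma cinner_sum_left: "cinner (sum f A) v = (\<Sum>i\<in>A. cinner (f i) v)"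
  by (induction A rule: infinite_finite_induct) (auto simp: cinner_add_left)

lemma cnj_cinner: "cnj (cinner v w) = cinner w v"
  by (simp add: cinner_def mult.commute)

lemma cinner_self: "cinner v v = of_real (\<Sum>a\<in>UNIV. (cmod (v $ a))\<^sup>2)"
  unfolding cinner_def of_real_sum by (rule sum.cong) (simp_all add: complex_norm_square mult.commute del: of_real_power)

lemma cinner_self_eq_0_iff: "cinner v v = 0 \<longleftrightarrow> v = 0"
  by (simp add: cinner_self sum_nonneg_eq_0_iff vec_eq_iff del: of_real_sum)

lemma cinner_axis: "cinner (axis a 1) v = v $ a"
  by (simp add: cinner_def axis_def if_distrib[where f=cnj] if_distrib[where f="\<lambda>x. x * _"] cong: if_cong)

lemma matrix_vector_mult_sum_left: "(\<Sum>i\<in>I. A i) *v v = (\<Sum>i\<in>I. A i *v v)"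
  by (induction I rule: infinite_finite_induct)
    (simp_all add: matrix_vector_mult_add_rdistrib)

lemma mat_mult_vector: "(mat c ** A) *v v = c *s (A *v v)"
  by (simp add: vec_eq_iff mat_def matrix_vector_mult_def matrix_matrix_mult_def sum_distrib_left
      mult.assoc if_distrib[where f="\<lambda>x. x * _"] cong: if_cong)

lemma mat_vector: "mat c *v v = c *s (v :: complex ^ 'd)"
  using mat_mult_vector[of c "mat 1" v] by simp

lemma scaleR_matrix_vector: "(r *\<^sub>R A) *v v = r *\<^sub>R (A *v (v :: complex ^ 'd))"
  by (simp add: vec_eq_iff matrix_vector_mult_def scaleR_sum_right)

lemma ketbra_vector: "ketbra v w *v z = cinner w z *s v"
  by (simp add: ketbra_def matrix_vector_mult_def cinner_def vec_eq_iff sum_distrib_left algebra_simps)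

lemma cinner_ketbra: "cinner a (ketbra v w *v z) = cinner a v * cinner w z"
  by (simp add: ketbra_vector cinner_scale_right)

lemma cinner_adjoint: "cinner v (adjoint_mat A *v w) = cinner (A *v v) w"
proof -
  have "cinner v (adjoint_mat A *v w) = (\<Sum>a\<in>UNIV. \<Sum>b\<in>UNIV. cnj (v $ a) * cnj (A $ b $ a) * w $ b)"
    by (simp add: cinner_def adjoint_mat_def matrix_vector_mult_def sum_distrib_left mult.assoc)
  also have "\<dots> = (\<Sum>b\<in>UNIV. \<Sum>a\<in>UNIV. cnj (v $ a) * cnj (A $ b $ a) * w $ b)"
    by (rule sum.swap)
  also have "\<dots> = cinner (A *v v) w"
    by (simp add: cinner_def matrix_vector_mult_def sum_distrib_left sum_distrib_right ac_simps)
  finally show ?thesis .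
qed

lemma cinner_mult_adjoint:
  "cinner v (A *v w) = cinner (adjoint_mat A *v v) w"
  by (metis cinner_adjoint cnj_cinner)

lemma trace_ketbra: "trace (ketbra v w) = cinner w v"
  by (simp add: trace_def ketbra_def cinner_def mult.commute)

lemma trace_eq_sum_cinner: "trace X = (\<Sum>a\<in>UNIV. cinner (axis a 1) (X *v axis a 1))"
  unfolding cinner_axis
  by (simp add: trace_def matrix_vector_mult_def axis_def if_distrib[where f="\<lambda>x. _ * x"] cong: if_cong)

section \<open>Two positivity facts: a trace bound and a positive block matrix\<close>

lemma nonneg_Reals_sum: "(\<And>i. i \<in> A \<Longrightarrow> f i \<in> \<real>\<^sub>\<ge>\<^sub>0) \<Longrightarrow> sum f A \<in> \<real>\<^sub>\<ge>\<^sub>0"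
  for f :: "'b \<Rightarrow> complex"
  by (induction A rule: infinite_finite_induct) auto

lemma cnj_mult_self_nonneg: "cnj z * z \<in> \<real>\<^sub>\<ge>\<^sub>0"
  by (simp add: complex_nonneg_Reals_iff)

text \<open>For \<open>a = 1 / cinner v v\<close> and \<open>b = 1 / cinner w w\<close> the left side is the trace of \<open>X\<close> compressed to
  the orthogonal complement of \<open>v\<close> and \<open>w\<close>; the hypotheses on \<open>a\<close>, \<open>b\<close> also allow zero vectors.\<close>

lemma trace_ge_two_directions:
  fixes X :: "complex ^ 'd ^ 'd"
  assumes X: "psd X" and ort: "cinner v w = 0"
    and a: "of_real (a * a) * cinner v v = of_real a" and b: "of_real (b * b) * cinner w w = of_real b"
  shows "trace X - of_real a * cinner v (X *v v) - of_real b * cinner w (X *v w) \<in> \<real>\<^sub>\<ge>\<^sub>0"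
proof -
  \<comment> \<open>The plan is to write the left side as the trace of \<open>q X q\<close>,
    computed as the sum of the forms of \<open>X\<close> at the images under \<open>q\<close> of the
    standard basis. Each of these forms is nonnegative.\<close>
  define q where "q z = z - (of_real a * cinner v z) *s v - (of_real b * cinner w z) *s w"
    for z :: "complex ^ 'd"
  have ort': "cinner w v = 0"
    using ort by (metis cnj_cinner complex_cnj_zero)
  \<comment> \<open>Completeness of the standard basis: it collapses every sum over \<open>k\<close>
    in the nine-term expansion of \<open>q z\<close> against \<open>X *v q z\<close>.\<close>
  have comp: "(\<Sum>k\<in>UNIV. cinner s (axis k 1) * cinner (axis k 1) t) = cinner s t"
    for s t :: "complex ^ 'd"
    by (simp add: cinner_axis cnj_cinner[of "axis _ _", symmetric]) (simp add: cinner_def)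
  have v1: "(\<Sum>k\<in>UNIV. cinner v (axis k 1) * cinner (axis k 1) (X *v s)) = cinner v (X *v s)" for v s :: "complex ^ 'd"
    by (rule comp)
  have v2: "(\<Sum>k\<in>UNIV. cinner s (X *v axis k 1) * cinner (axis k 1) t) = cinner s (X *v t)" for s t :: "complex ^ 'd"
    unfolding cinner_mult_adjoint by (rule comp)
  let ?a = "of_real a :: complex" and ?b = "of_real b :: complex"
  have "cinner (q z) (X *v q z) = cinner z (X *v z)
      - ?a * (cinner v z * cinner z (X *v v)) - ?b * (cinner w z * cinner z (X *v w))
      - ?a * (cinner v (X *v z) * cinner z v) - ?b * (cinner w (X *v z) * cinner z w)
      + ?a * ?a * cinner v (X *v v) * (cinner v z * cinner z v) + ?b * ?b * cinner w (X *v w) * (cinner w z * cinner z w)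
      + ?a * ?b * cinner v (X *v w) * (cinner w z * cinner z v) + ?a * ?b * cinner w (X *v v) * (cinner v z * cinner z w)" for z
    unfolding q_def
    by (simp add: matrix_vector_mult_diff_distrib vector_scalar_commute cinner_diff_left cinner_diff_right
        matrix_vector_right_distrib cinner_add_left cinner_add_right
        cinner_scale_left cinner_scale_right cnj_cinner algebra_simps)
  then have "(\<Sum>k\<in>UNIV. cinner (q (axis k 1)) (X *v q (axis k 1))) = trace X 
      - ?a * cinner v (X *v v) - ?b * cinner w (X *v w) - ?a * cinner v (X *v v) - ?b * cinner w (X *v w)
      + ?a * ?a * cinner v (X *v v) * cinner v v + ?b * ?b * cinner w (X *v w) * cinner w w
      + ?a * ?b * cinner v (X *v w) * cinner w v + ?a * ?b * cinner w (X *v v) * cinner v w"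
    by (simp only: sum.distrib sum_subtractf sum_distrib_left[symmetric] v1 v2 comp trace_eq_sum_cinner)
  also have "\<dots> = trace X - ?a * cinner v (X *v v) - ?b * cinner w (X *v w)
      + (?a * ?a * cinner v v - ?a) * cinner v (X *v v) + (?b * ?b * cinner w w - ?b) * cinner w (X *v w)"
    by (simp add: ort ort' algebra_simps)
  \<comment> \<open>The mixed terms are gone by orthogonality. The two remaining brackets are zero
    by the hypotheses on \<open>a\<close> and \<open>b\<close>.\<close>
  also have "\<dots> = trace X - ?a * cinner v (X *v v) - ?b * cinner w (X *v w)"
  proof -
    have "?a * ?a * cinner v v - ?a = 0" "?b * ?b * cinner w w - ?b = 0"
      using a b by (simp_all only: of_real_mult right_minus_eq)
    then show ?thesis
      by (simp only: mult_zero_left add_0_right)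
  qed
  finally show ?thesis
    using X by (metis (no_types, lifting) nonneg_Reals_sum psd_def)
qed

text \<open>The quadratic form of the first and last summands together is half the sum over \<open>i, j\<close> of
  \<open>|cinner (b i) (v j) + cinner (b j) (v i)|\<^sup>2\<close>.\<close>

lemma psd_block_isotropic_plus_swap:
  fixes P :: "complex ^ 'd ^ 'd"
  assumes P: "\<And>v. (\<Sum>i<n. cinner v (b i) * cinner (b i) v) = cinner v (P *v v)"
  shows "psd_block n (\<lambda>i j. (if i = j then P else 0) + ketbra (a i) (a j) + ketbra (b j) (b i))"
  unfolding psd_block_def
proof
  fix v :: "nat \<Rightarrow> complex ^ 'd"
  \<comment> \<open>In these overlaps the diagonal summand gives the sum of
    \<open>|W i j|\<^sup>2\<close>, the swap-like summand pairs \<open>W\<close> with its transpose,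
    and the rank-one summand gives \<open>|?s|\<^sup>2\<close>.\<close>
  define W where "W i j = cinner (b i) (v j)" for i j
  let ?s = "\<Sum>i<n. cinner (a i) (v i)"
  have W: "cinner (v j) (b i) = cnj (W i j)" for i j
    by (simp add: W_def cnj_cinner)
  have "(\<Sum>i<n. \<Sum>j<n. cinner (v i) (((if i = j then P else 0) + ketbra (a i) (a j) + ketbra (b j) (b i)) *v v j))
     = (\<Sum>i<n. \<Sum>j<n. (if i = j then cinner (v i) (P *v v j) else 0)) +
       (\<Sum>i<n. \<Sum>j<n. cnj (W j i) * W i j) + (\<Sum>i<n. \<Sum>j<n. cinner (v i) (a i) * cinner (a j) (v j))"
    unfolding sum.distrib[symmetric]
    by (intro sum.cong refl)
      (simp add: matrix_vector_mult_add_rdistrib cinner_add_right cinner_ketbra W W_def[symmetric] ac_simps)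
  also have "(\<Sum>i<n. \<Sum>j<n. cinner (v i) (a i) * cinner (a j) (v j)) = cnj ?s * ?s"
    by (simp add: sum_product cnj_cinner)
  also have "(\<Sum>i<n. \<Sum>j<n. (if i = j then cinner (v i) (P *v v j) else 0)) = (\<Sum>i<n. \<Sum>j<n. cnj (W i j) * W i j)"
    by (subst (2) sum.swap) (simp add: P[symmetric] W W_def)
  finally have eq: "(\<Sum>i<n. \<Sum>j<n. cinner (v i) (((if i = j then P else 0) + ketbra (a i) (a j) + ketbra (b j) (b i)) *v v j))
     = (\<Sum>i<n. \<Sum>j<n. cnj (W i j) * W i j) + (\<Sum>i<n. \<Sum>j<n. cnj (W j i) * W i j) + cnj ?s * ?s" .
  have "(\<Sum>i<n. \<Sum>j<n. cnj (W i j + W j i) * (W i j + W j i)) =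
      (\<Sum>i<n. \<Sum>j<n. cnj (W i j) * W i j) + (\<Sum>i<n. \<Sum>j<n. cnj (W j i) * W i j) +
      ((\<Sum>i<n. \<Sum>j<n. cnj (W j i) * W j i) + (\<Sum>i<n. \<Sum>j<n. cnj (W i j) * W j i))"
    by (simp add: sum.distrib[symmetric] algebra_simps)
  also have "(\<Sum>i<n. \<Sum>j<n. cnj (W j i) * W j i) = (\<Sum>i<n. \<Sum>j<n. cnj (W i j) * W i j)"
    by (rule sum.swap)
  also have "(\<Sum>i<n. \<Sum>j<n. cnj (W i j) * W j i) = (\<Sum>i<n. \<Sum>j<n. cnj (W j i) * W i j)"
    by (rule sum.swap)
  finally have "(\<Sum>i<n. \<Sum>j<n. cnj (W i j) * W i j) + (\<Sum>i<n. \<Sum>j<n. cnj (W j i) * W i j) =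
      of_real (1 / 2) * (\<Sum>i<n. \<Sum>j<n. cnj (W i j + W j i) * (W i j + W j i))"
    by simp
  also have "\<dots> \<in> \<real>\<^sub>\<ge>\<^sub>0"
    by (intro nonneg_Reals_mult_I nonneg_Reals_sum cnj_mult_self_nonneg) simp
  finally have "(\<Sum>i<n. \<Sum>j<n. cnj (W i j) * W i j) + (\<Sum>i<n. \<Sum>j<n. cnj (W j i) * W i j) + cnj ?s * ?s \<in> \<real>\<^sub>\<ge>\<^sub>0"
    by (rule nonneg_Reals_add_I) (rule cnj_mult_self_nonneg)
  then show "(\<Sum>i<n. \<Sum>j<n. cinner (v i) (((if i = j then P else 0) + ketbra (a i) (a j) + ketbra (b j) (b i)) *v v j)) \<in> \<real>\<^sub>\<ge>\<^sub>0"
    unfolding eq .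
qed

section \<open>Coordinates, conjugation and transposition in an orthonormal basis\<close>

locale orthonormal_frame =
  fixes e :: "nat \<Rightarrow> complex ^ 'd"
  assumes basis: "orthonormal_basis e"
begin

lemma cinner_basis: "i < CARD('d) \<Longrightarrow> j < CARD('d) \<Longrightarrow> cinner (e i) (e j) = (if i = j then 1 else 0)"
  using basis by (simp add: orthonormal_basis_def)

text \<open>Both sides are linear in \<open>v\<close> and agree on the basis vectors, so span
  induction suffices.\<close>

lemma expand: "v = (\<Sum>i<CARD('d). cinner (e i) v *s e i)"
proof -
  have "v \<in> vec.span (e ` {..<CARD('d)})"
    using basis by (simp add: orthonormal_basis_def)
  then show ?thesis
  proof (induction rule: vec.span_induct_alt)
    case base
    then show ?case by simp
  next
    case (step c x y)
    then obtain j where j: "j < CARD('d)" "x = e j" by auto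
    have "(\<Sum>i<CARD('d). cinner (e i) x *s e i) = (\<Sum>i<CARD('d). (if i = j then 1 else 0) *s e i)"
      using j by (intro sum.cong) (auto simp: cinner_basis)
    also have "\<dots> = x"
      using j by (simp add: if_distrib[where f="\<lambda>x. x *s _"] cong: if_cong)
    finally have x: "(\<Sum>i<CARD('d). cinner (e i) x *s e i) = x" .
    have "(\<Sum>i<CARD('d). cinner (e i) (c *s x + y) *s e i) =
        c *s (\<Sum>i<CARD('d). cinner (e i) x *s e i) + (\<Sum>i<CARD('d). cinner (e i) y *s e i)"
      by (simp add: cinner_add_right cinner_scale_right vec.scale_left_distrib sum.distrib
          vec.scale_sum_right)
    then show ?case
      unfolding x step(2)[symmetric] ..
  qed
qed

lemma parseval: "cinner v w = (\<Sum>i<CARD('d). cinner v (e i) * cinner (e i) w)"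
  by (subst expand[of w]) (simp add: cinner_sum_right cinner_scale_right mult.commute)

lemma vec_eqI: "(\<And>i. i < CARD('d) \<Longrightarrow> cinner (e i) v = cinner (e i) w) \<Longrightarrow> v = w"
  by (subst expand[of v], subst expand[of w]) simp

lemma cinner_matrix:
  "cinner v (X *v w) = (\<Sum>i<CARD('d). \<Sum>j<CARD('d). cinner v (e i) * cinner (e i) (X *v e j) * cinner (e j) w)"
proof -
  have "cinner (e i) (X *v w) = (\<Sum>j<CARD('d). cinner (e i) (X *v e j) * cinner (e j) w)" for i
    unfolding cinner_mult_adjoint by (rule parseval)
  then show ?thesis
    by (subst parseval) (simp add: sum_distrib_left mult.assoc)
qed

lemma matrix_eqI:
  assumes "\<And>i j. i < CARD('d) \<Longrightarrow> j < CARD('d) \<Longrightarrow> cinner (e i) (X *v e j) = cinner (e i) (Y *v e j)"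
  shows "X = Y"
proof -
  have "cinner v (X *v w) = cinner v (Y *v w)" for v w
    by (subst (1 2) cinner_matrix) (simp add: assms)
  then have "X *v w = Y *v w" for w
    by (intro vec_eqI) auto
  then show ?thesis by (simp add: matrix_eq)
qed

text \<open>Coordinatewise complex conjugation: the antilinear involution that fixes every
  \<open>e i\<close>.\<close>

definition conj_wrt :: "complex ^ 'd \<Rightarrow> complex ^ 'd" where
  "conj_wrt v = (\<Sum>i<CARD('d). cnj (cinner (e i) v) *s e i)"

lemma cinner_conj_wrt: 
  assumes "i < CARD('d)"
  shows "cinner (e i) (conj_wrt v) = cinner v (e i)" "cinner (conj_wrt v) (e i) = cinner (e i) v"
proof -
  have "cinner (e i) (conj_wrt v) = (\<Sum>j<CARD('d). if j = i then cnj (cinner (e j) v) else 0)"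
    unfolding conj_wrt_def cinner_sum_right
    by (rule sum.cong) (simp_all add: cinner_scale_right cinner_basis assms)
  then show *: "cinner (e i) (conj_wrt v) = cinner v (e i)"
    using assms by (simp add: cnj_cinner)
  show "cinner (conj_wrt v) (e i) = cinner (e i) v"
    using arg_cong[OF *, of cnj] by (simp add: cnj_cinner)
qed

lemma cinner_conj_wrt_conj_wrt: "cinner (conj_wrt v) (conj_wrt w) = cinner w v"
  by (subst (1 2) parseval) (auto simp: cinner_conj_wrt intro!: sum.cong)

lemma transpose_wrt_entry:
  assumes "i < CARD('d)" "j < CARD('d)"
  shows "cinner (e i) (transpose_wrt e X *v e j) = cinner (e j) (X *v e i)"
proof -
  have "cinner (e i) (transpose_wrt e X *v e j) =
    (\<Sum>k<CARD('d). \<Sum>l<CARD('d). if l = i then if k = j then cinner (e k) (X *v e l) else 0 else 0)"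
    unfolding transpose_wrt_def matrix_vector_mult_sum_left cinner_sum_right
    by (intro sum.cong) (simp_all add: mat_mult_vector cinner_scale_right cinner_ketbra cinner_basis assms)
  then show ?thesis using assms by simp
qed

text \<open>Transposition exchanges the two indices of the coefficient array, and conjugation turns
  the coordinates of each argument into those required on the other side. Thus quadratic forms of a
  transpose become quadratic forms of \<open>X\<close> itself.\<close>

lemma cinner_transpose_wrt: "cinner v (transpose_wrt e X *v w) = cinner (conj_wrt w) (X *v conj_wrt v)"
proof -
  have "cinner v (transpose_wrt e X *v w) = 
    (\<Sum>i<CARD('d). \<Sum>j<CARD('d). cinner v (e i) * cinner (e j) (X *v e i) * cinner (e j) w)"
    by (subst cinner_matrix) (auto simp: transpose_wrt_entry intro!: sum.cong)
  also have "\<dots> = (\<Sum>j<CARD('d). \<Sum>i<CARD('d). cinner (conj_wrt w) (e j) * cinner (e j) (X *v e i) * cinner (e i) (conj_wrt v))"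
    by (subst sum.swap) (auto simp: cinner_conj_wrt intro!: sum.cong)
  also have "\<dots> = cinner (conj_wrt w) (X *v conj_wrt v)"
    by (rule cinner_matrix[symmetric])
  finally show ?thesis .
qed

lemma transpose_wrt_transpose_wrt: "transpose_wrt e (transpose_wrt e X) = X"
  by (rule matrix_eqI) (simp add: transpose_wrt_entry)

lemma transpose_wrt_add: "transpose_wrt e (X + Y) = transpose_wrt e X + transpose_wrt e Y"
  by (rule matrix_eqI)
    (simp add: transpose_wrt_entry matrix_vector_mult_add_rdistrib cinner_add_right)

lemma transpose_wrt_mat_mult: "transpose_wrt e (mat c ** X) = mat c ** transpose_wrt e X"
  by (rule matrix_eqI)
    (simp add: transpose_wrt_entry mat_mult_vector cinner_scale_right)

lemma transpose_wrt_zero: "transpose_wrt e 0 = 0"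
  by (rule matrix_eqI) (simp add: transpose_wrt_entry)

lemma transpose_wrt_ketbra: "transpose_wrt e (ketbra v w) = ketbra (conj_wrt w) (conj_wrt v)"
  by (rule matrix_eqI) (simp add: transpose_wrt_entry cinner_ketbra cinner_conj_wrt)

lemma cinner_chi_map:
  "cinner v (chi_map e U x y X *v w) = trace X * cinner v w - of_real y * cinner v (X *v w)
     - of_real x * cinner (adjoint_mat U *v v) (transpose_wrt e X *v (adjoint_mat U *v w))"
  by (simp add: chi_map_def matrix_vector_mult_diff_rdistrib mat_vector scaleR_matrix_vector
      cinner_diff_right cinner_scale_right cinner_scaleR_right matrix_vector_mul_assoc[symmetric]
      cinner_mult_adjoint[of _ U])


lemma complex_linear_chi_map: "complex_linear_map (chi_map e U x y)"
  unfolding complex_linear_map_def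
proof (intro conjI allI)
  fix X Y :: "complex ^ 'd ^ 'd" and c
  show "chi_map e U x y (X + Y) = chi_map e U x y X + chi_map e U x y Y"
    by (rule matrix_eqI)
      (simp add: cinner_chi_map transpose_wrt_add trace_add matrix_vector_mult_add_rdistrib
        cinner_add_right algebra_simps)
  have "trace (mat c ** X) = c * trace X"
    by (simp add: trace_eq_sum_cinner mat_mult_vector cinner_scale_right sum_distrib_left)
  then show "chi_map e U x y (mat c ** X) = mat c ** chi_map e U x y X"
    by (intro matrix_eqI)
      (simp add: cinner_chi_map transpose_wrt_mat_mult mat_mult_vector cinner_scale_right algebra_simps)
qed

lemma conj_wrt_conj_wrt: "conj_wrt (conj_wrt v) = v"
  by (rule vec_eqI) (simp add: cinner_conj_wrt)

lemma conj_wrt_basis: "i < CARD('d) \<Longrightarrow> conj_wrt (e i) = e i"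
  by (rule vec_eqI) (simp add: cinner_conj_wrt cinner_basis)

end

section \<open>Antisymmetric partial isometries supported on the first \<open>n\<close> basis
  vectors\<close>

locale antisymmetric_partial_isometry = orthonormal_frame e for e :: "nat \<Rightarrow> complex ^ 'd" +
  fixes U :: "complex ^ 'd ^ 'd" and n :: nat
  assumes n_le: "n \<le> CARD('d)"
    and isometry: "i < n \<Longrightarrow> j < n \<Longrightarrow> cinner (U *v e i) (U *v e j) = (if i = j then 1 else 0)"
    and kernel: "n \<le> j \<Longrightarrow> j < CARD('d) \<Longrightarrow> U *v e j = 0"
    and antisymmetric: "transpose_wrt e U = - U"
begin

definition P :: "complex ^ 'd ^ 'd" where
  "P = (\<Sum>i<n. ketbra (e i) (e i))"

lemma cinner_P: "cinner v (P *v w) = (\<Sum>i<n. cinner v (e i) * cinner (e i) w)"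
  by (simp add: P_def matrix_vector_mult_sum_left cinner_sum_right cinner_ketbra)

lemma cinner_P_basis: 
  assumes "i < n" "j < n"
  shows "cinner (e i) (P *v e j) = (if i = j then 1 else 0)"
proof -
  have "cinner (e i) (P *v e j) = (\<Sum>k<n. if k = i then (if i = j then 1 else 0) else 0)"
    unfolding cinner_P using n_le assms by (intro sum.cong) (auto simp: cinner_basis)
  then show ?thesis using assms by simp
qed

lemma trace_P: "trace P = of_nat n"
proof -
  have "trace P = (\<Sum>i<n. trace (ketbra (e i) (e i)))"
    unfolding P_def by (simp add: trace_def sum.swap[of _ UNIV])
  also have "\<dots> = (\<Sum>i<n. 1)"
    using n_le by (intro sum.cong) (auto simp: trace_ketbra cinner_basis)
  finally show ?thesis by simp
qed

lemma transpose_wrt_P: "transpose_wrt e P = P"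
proof (rule matrix_eqI)
  fix i j assume ij: "i < CARD('d)" "j < CARD('d)"
  show "cinner (e i) (transpose_wrt e P *v e j) = cinner (e i) (P *v e j)"
    unfolding transpose_wrt_entry[OF ij] cinner_P using ij n_le
    by (intro sum.cong) (auto simp: cinner_basis)
qed

text \<open>Basis-free form of antisymmetry. With \<open>w = conj_wrt v\<close> both sides carry the
  same number with opposite signs, so it vanishes.\<close>

lemma cinner_U_antisym: "cinner v (U *v w) = - cinner (conj_wrt w) (U *v conj_wrt v)"
proof -
  have "cinner v (- U *v w) = cinner (conj_wrt w) (U *v conj_wrt v)"
    unfolding antisymmetric[symmetric] by (rule cinner_transpose_wrt)
  moreover have "- U *v w = - (U *v w)"
    by (simp add: vec_eq_iff matrix_vector_mult_def sum_negf)
  ultimately show ?thesis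
    by (simp add: cinner_minus_right equation_minus_iff)
qed

lemma entry_antisym:
  "i < CARD('d) \<Longrightarrow> j < CARD('d) \<Longrightarrow> cinner (e i) (U *v e j) = - cinner (e j) (U *v e i)"
  using cinner_U_antisym[of "e i" "e j"] by (simp add: conj_wrt_basis)

text \<open>The adjoint is the conjugate of the transpose, and the transpose is
  \<open>- U\<close>.\<close>

lemma adjoint_mult_vector: "adjoint_mat U *v v = - conj_wrt (U *v conj_wrt v)"
proof (rule vec_eqI)
  fix i assume i: "i < CARD('d)"
  have "cinner (e i) (conj_wrt (U *v conj_wrt v)) = cnj (cinner (e i) (U *v conj_wrt v))"
    using i by (simp add: cinner_conj_wrt cnj_cinner)
  also have "\<dots> = - cnj (cinner v (U *v e i))"
    by (subst cinner_U_antisym) (simp add: conj_wrt_conj_wrt conj_wrt_basis i)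
  finally show "cinner (e i) (adjoint_mat U *v v) = cinner (e i) (- conj_wrt (U *v conj_wrt v))"
    by (simp add: cinner_adjoint cinner_minus_right cnj_cinner)
qed

lemma U_mult_vector: "U *v v = (\<Sum>i<n. cinner (e i) v *s (U *v e i))"
proof -
  have "U *v v = (\<Sum>i<CARD('d). cinner (e i) v *s (U *v e i))"
    by (subst expand[of v]) (simp add: linear_sum[OF matrix_vector_mul_linear] vector_scalar_commute)
  also have "\<dots> = (\<Sum>i<n. cinner (e i) v *s (U *v e i))"
    using n_le by (intro sum.mono_neutral_right) (auto simp: kernel not_less)
  finally show ?thesis .
qed

text \<open>This is \<open>U\<^sup>* U = P\<close>: the kernel removes the coordinates from
  \<open>n\<close> on, and the images of the others are orthonormal.\<close>

lemma cinner_U_U: "cinner (U *v v) (U *v w) = cinner v (P *v w)"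
proof -
  have "cinner (U *v v) (U *v w) =
      (\<Sum>i<n. \<Sum>j<n. if j = i then cinner v (e i) * cinner (e j) w else 0)"
    unfolding U_mult_vector[of v] U_mult_vector[of w] cinner_sum_left cinner_sum_right
    by (intro sum.cong) (simp_all add: cinner_scale_left cinner_scale_right isometry cnj_cinner)
  also have "\<dots> = cinner v (P *v w)"
    by (simp add: cinner_P)
  finally show ?thesis .
qed

text \<open>This is \<open>U U\<^sup>* = P\<close>, so range and support coincide. Up to sign the
  adjoint is \<open>U\<close> conjugated by \<open>conj_wrt\<close>, and \<open>P\<close> is
  invariant under transposition.\<close>

lemma cinner_adjoint_adjoint: "cinner (adjoint_mat U *v v) (adjoint_mat U *v w) = cinner v (P *v w)"
proof -
  have "cinner (adjoint_mat U *v v) (adjoint_mat U *v w) = cinner (conj_wrt w) (P *v conj_wrt v)"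
    by (simp add: adjoint_mult_vector cinner_minus_left cinner_minus_right
        cinner_conj_wrt_conj_wrt cinner_U_U)
  also have "\<dots> = cinner v (P *v w)"
    by (simp add: cinner_transpose_wrt[symmetric] transpose_wrt_P)
  finally show ?thesis .
qed

text \<open>The kernel terms can be added for free; the full sum is then Parseval's identity for the
  adjoint images of \<open>v\<close> and \<open>w\<close>.\<close>

lemma sum_range_projection:
  "(\<Sum>i<n. cinner v (U *v e i) * cinner (U *v e i) w) = cinner v (P *v w)"
proof -
  have "(\<Sum>i<n. cinner v (U *v e i) * cinner (U *v e i) w) =
      (\<Sum>i<CARD('d). cinner v (U *v e i) * cinner (U *v e i) w)"
    using n_le by (intro sum.mono_neutral_left) (auto simp: kernel not_less)
  also have "\<dots> = (\<Sum>i<CARD('d). cinner (adjoint_mat U *v v) (e i) * cinner (e i) (adjoint_mat U *v w))"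
    by (simp add: cinner_adjoint cinner_mult_adjoint[of v U])
  also have "\<dots> = cinner (adjoint_mat U *v v) (adjoint_mat U *v w)"
    by (rule parseval[symmetric])
  finally show ?thesis by (simp add: cinner_adjoint_adjoint)
qed

section \<open>Positivity of the map\<close>

lemma psd_chi_map:
  assumes x: "0 \<le> x" "x \<le> 1" and y: "0 \<le> y" "y \<le> 1" and X: "psd X"
  shows "psd (chi_map e U x y X)"
  unfolding psd_def
proof
  fix v
  define w where "w = conj_wrt (adjoint_mat U *v v)"
  define N where "N = Re (cinner v v)"
  define M where "M = Re (cinner w w)"
  define p where "p = Re (cinner v (X *v v))"
  define r where "r = Re (cinner w (X *v w))"
  have "w = - (U *v conj_wrt v)"
  proof (rule vec_eqI)
    fix i assume i: "i < CARD('d)"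
    show "cinner (e i) w = cinner (e i) (- (U *v conj_wrt v))"
      using i by (simp add: w_def cinner_conj_wrt adjoint_mult_vector cinner_minus_left cinner_minus_right)
  qed
  moreover have "cinner v (U *v conj_wrt v) = 0"
    using cinner_U_antisym[of v "conj_wrt v"] by (simp add: conj_wrt_conj_wrt)
  ultimately have ort: "cinner v w = 0"
    by (simp add: cinner_minus_right)
  have N: "cinner v v = of_real N" and M: "cinner w w = of_real M"
    by (simp_all add: N_def M_def cinner_self)
  have p: "cinner v (X *v v) = of_real p" "0 \<le> p" and r: "cinner w (X *v w) = of_real r" "0 \<le> r"
    using X by (auto simp: psd_def complex_nonneg_Reals_iff p_def r_def complex_eq_iff)
  \<comment> \<open>The difference is the squared norm of the component of \<open>v\<close>
    orthogonal to the support of \<open>U\<close>.\<close>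
  have "cinner v v - cinner w w = (\<Sum>i<CARD('d). cinner v (e i) * cinner (e i) v) - (\<Sum>i<n. cinner v (e i) * cinner (e i) v)"
    unfolding w_def cinner_conj_wrt_conj_wrt cinner_adjoint_adjoint cinner_P parseval[of v v] ..
  also have "\<dots> = (\<Sum>i\<in>{..<CARD('d)} - {..<n}. cnj (cinner (e i) v) * cinner (e i) v)"
    using n_le by (subst sum_diff) (auto simp: cnj_cinner)
  also have "\<dots> \<in> \<real>\<^sub>\<ge>\<^sub>0"
    by (intro nonneg_Reals_sum cnj_mult_self_nonneg)
  finally have MN: "M \<le> N"
    by (simp add: N M complex_nonneg_Reals_iff)
  have M0: "0 \<le> M"
    by (simp add: M_def cinner_self sum_nonneg del: of_real_sum)
  \<comment> \<open>Since \<open>inverse 0 = 0\<close>, the conditions on the two coefficients hold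
    even if \<open>v\<close> or \<open>w\<close> is zero.\<close>
  have "trace X - of_real (inverse N) * cinner v (X *v v) - of_real (inverse M) * cinner w (X *v w) \<in> \<real>\<^sub>\<ge>\<^sub>0"
    by (rule trace_ge_two_directions[OF X ort]) (auto simp: N M field_simps)
  then have "trace X - of_real (inverse N * p + inverse M * r) \<in> \<real>\<^sub>\<ge>\<^sub>0"
    by (simp only: p r of_real_mult of_real_add diff_diff_eq)
  then have "Im (trace X) = 0" and t: "inverse N * p + inverse M * r \<le> Re (trace X)"
    by (simp_all add: complex_nonneg_Reals_iff del: of_real_mult of_real_add)
  then obtain t where tr: "trace X = of_real t"
    by (metis complex_is_Real_iff Reals_cases)
  have "y * p + x * r \<le> t * N"
  \<comment> \<open>A zero norm makes the corresponding form zero as well. Otherwise the trace bound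
    is multiplied by \<open>N\<close>, and the resulting coefficient \<open>N / M\<close> of
    \<open>r\<close> is at least 1.\<close>
  proof (cases "M = 0")
    case True
    then have "w = 0" 
      using M by (simp add: cinner_self_eq_0_iff)
    then have "r = 0" by (simp add: r_def)
    show ?thesis
    proof (cases "N = 0")
      case True
      then have "v = 0" 
        using N by (simp add: cinner_self_eq_0_iff)
      then have "p = 0" by (simp add: p_def)
      then show ?thesis using \<open>r = 0\<close> True by simp
    next
      case False
      then have "p \<le> t * N"
        using t MN M0 \<open>r = 0\<close> by (simp add: tr field_simps)
      moreover have "y * p \<le> p"
        using y p by (simp add: mult_left_le_one_le)
      ultimately show ?thesis using \<open>r = 0\<close> by simp
    qed
  next
    case False
    then have pos: "0 < M" "0 < N" using M0 MN by auto
    have "(inverse N * p + inverse M * r) * N \<le> t * N"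
      using t pos by (intro mult_right_mono) (auto simp: tr)
    moreover have "(inverse N * p + inverse M * r) * N = p + (N / M) * r"
      using pos by (simp add: field_simps)
    moreover have "r \<le> (N / M) * r"
      using pos MN r mult_right_mono[of 1 "N / M" r] by simp
    moreover have "y * p \<le> p" "x * r \<le> r"
      using x y p r by (simp_all add: mult_left_le_one_le)
    ultimately show ?thesis by linarith
  qed
  moreover have "cinner v (chi_map e U x y X *v v) = of_real (t * N - y * p - x * r)"
    unfolding cinner_chi_map cinner_transpose_wrt w_def[symmetric] by (simp add: tr N p r)
  ultimately show "cinner v (chi_map e U x y X *v v) \<in> \<real>\<^sub>\<ge>\<^sub>0"
    by (simp add: complex_nonneg_Reals_iff del: of_real_diff of_real_mult)
qed

section \<open>The block matrix that detects indecomposability\<close>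

definition g :: "nat \<Rightarrow> complex ^ 'd" where
  "g i = conj_wrt (U *v e i)"

definition B :: "nat \<Rightarrow> nat \<Rightarrow> complex ^ 'd ^ 'd" where
  "B i j = (if i = j then P else 0) + ketbra (e i) (e j) + ketbra (U *v e j) (U *v e i)"

lemma transpose_wrt_B:
  assumes "i < n" "j < n"
  shows "transpose_wrt e (B i j) = (if i = j then P else 0) + ketbra (g i) (g j) + ketbra (e j) (e i)"
  using assms n_le
  by (simp add: B_def g_def transpose_wrt_add transpose_wrt_ketbra transpose_wrt_P transpose_wrt_zero conj_wrt_basis)

text \<open>Here the vectors \<open>U *v e i\<close> resolve \<open>P\<close>; for the blockwise
  transpose below, the basis vectors themselves do.\<close>

lemma psd_block_B: "psd_block n B"
  unfolding B_def[abs_def] by (rule psd_block_isotropic_plus_swap) (rule sum_range_projection)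

lemma psd_block_transpose_wrt_B: "psd_block n (\<lambda>i j. transpose_wrt e (B i j))"
proof -
  have "psd_block n (\<lambda>i j. (if i = j then P else 0) + ketbra (g i) (g j) + ketbra (e j) (e i))"
    by (rule psd_block_isotropic_plus_swap) (simp add: cinner_P)
  then show ?thesis
    by (simp add: psd_block_def transpose_wrt_B)
qed

text \<open>The sum is a block quadratic form at the direct-sum vector with components
  \<open>e i\<close>. The copositive part is handled by transposing twice: \<open>\<phi>2\<close> at
  \<open>B i j\<close> is the completely positive \<open>\<phi>2 \<circ> transpose_wrt e\<close> at
  the transposed block.\<close>

lemma decomposable_pairing_nonneg:
  assumes "decomposable e \<phi>"
  shows "(\<Sum>i<n. \<Sum>j<n. cinner (e i) (\<phi> (B i j) *v e j)) \<in> \<real>\<^sub>\<ge>\<^sub>0"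
proof -
  obtain \<phi>1 \<phi>2 where 1: "completely_positive \<phi>1" and 2: "completely_positive (\<phi>2 \<circ> transpose_wrt e)"
    and \<phi>: "\<And>X. \<phi> X = \<phi>1 X + \<phi>2 X"
    using assms by (auto simp: decomposable_def completely_copositive_def)
  have "psd_block n (\<lambda>i j. \<phi>1 (B i j))"
    using 1 psd_block_B by (auto simp: completely_positive_def)
  moreover have "psd_block n (\<lambda>i j. (\<phi>2 \<circ> transpose_wrt e) (transpose_wrt e (B i j)))"
    using 2 psd_block_transpose_wrt_B unfolding completely_positive_def by blast
  ultimately show ?thesis
    unfolding psd_block_def
    by (simp add: \<phi> matrix_vector_mult_add_rdistrib cinner_add_right sum.distrib transpose_wrt_transpose_wrt nonneg_Reals_add_I)
qed

text \<open>The trace term contributes \<open>n * (n + 2)\<close>, from the diagonal blocks alone.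
  Each of the two subtracted forms sums to \<open>n + n\<^sup>2 - n\<close>: the diagonal part, the
  constant 1, and minus the squared moduli of the entries of \<open>U\<close>.\<close>

lemma chi_map_pairing:
  "(\<Sum>i<n. \<Sum>j<n. cinner (e i) (chi_map e U x y (B i j) *v e j)) =
     of_real (real n * (real n + 2) - (x + y) * (real n)\<^sup>2)"
proof -
  define u where "u i j = cinner (e i) (U *v e j)" for i j
  have u: "u i j = - u j i" if "i < n" "j < n" for i j
    using entry_antisym[of i j] that n_le by (simp add: u_def)
  have g: "adjoint_mat U *v e i = - g i" if "i < n" for i
    using that n_le by (simp add: adjoint_mult_vector g_def conj_wrt_basis)
  have gg: "cinner (g i) (g j) = (if i = j then 1 else 0)" if "i < n" "j < n" for i j
    using that by (auto simp: g_def cinner_conj_wrt_conj_wrt isometry)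
  have gP: "cinner (g i) (P *v g j) = (if i = j then 1 else 0)" if ij: "i < n" "j < n" for i j
  proof -
    \<comment> \<open>Antisymmetry makes the rows of \<open>U\<close> from \<open>n\<close> on
      vanish along with the columns, so \<open>g j\<close> lies in the range of
      \<open>P\<close>.\<close>
    have vanish: "cinner (e k) (g j) = 0" if k: "n \<le> k" "k < CARD('d)" for k
    proof -
      have "cinner (e k) (U *v e j) = 0"
        using k ij n_le by (subst entry_antisym) (simp_all add: kernel)
      then have "cinner (U *v e j) (e k) = 0"
        by (metis cnj_cinner complex_cnj_zero)
      then show ?thesis
        using k by (simp add: g_def cinner_conj_wrt)
    qed
    have "cinner (g i) (P *v g j) = (\<Sum>k<CARD('d). cinner (g i) (e k) * cinner (e k) (g j))"
      unfolding cinner_P using n_le by (intro sum.mono_neutral_left) (auto simp: vanish not_less)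
    then show ?thesis
      using ij by (simp add: parseval[symmetric] gg)
  qed
  have trB: "trace (B i j) = (if i = j then of_nat n + 2 else 0)" if "i < n" "j < n" for i j
    using that n_le by (auto simp: B_def trace_add trace_ketbra trace_P cinner_basis isometry trace_0[unfolded mat_0])
  \<comment> \<open>The last summand of \<open>B i j\<close> gives a product of an entry of
    \<open>U\<close> with the conjugate of the transposed entry; antisymmetry turns it into minus a
    squared modulus. The same happens for the transposed block in \<open>gB\<close>.\<close>
  have eB: "cinner (e i) (B i j *v e j) = (if i = j then 1 else 0) + 1 - cnj (u i j) * u i j"
    if ij: "i < n" "j < n" for i j
  proof -
    have "cinner (U *v e i) (e j) = - cnj (u i j)"
      using u[OF ij] by (simp add: u_def cnj_cinner)
    then show ?thesis
      using ij n_le by (auto simp: B_def matrix_vector_mult_add_rdistrib cinner_add_right cinner_ketbra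
          cinner_basis cinner_P_basis u_def[symmetric])
  qed
  have gB: "cinner (g i) (transpose_wrt e (B i j) *v g j) = (if i = j then 1 else 0) + 1 - cnj (u i j) * u i j"
    if ij: "i < n" "j < n" for i j
  proof -
    have "cinner (g i) (e j) = - u i j"
      using u[OF ij] ij n_le by (simp add: u_def g_def cinner_conj_wrt)
    moreover have "cinner (e i) (g j) = cnj (u i j)"
      using ij n_le by (simp add: u_def g_def cinner_conj_wrt cnj_cinner)
    ultimately show ?thesis
      using ij by (auto simp: transpose_wrt_B matrix_vector_mult_add_rdistrib cinner_add_right cinner_ketbra gP gg)
  qed
  \<comment> \<open>Each column of the array \<open>u\<close> has norm 1: after an exchange of
    indices by antisymmetry, its squared norm is a diagonal entry of \<open>P\<close>.\<close>
  have "(\<Sum>i<n. \<Sum>j<n. cnj (u i j) * u i j) = (\<Sum>j<n. \<Sum>i<n. cnj (u i j) * u i j)"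
    by (rule sum.swap)
  also have "\<dots> = (\<Sum>j<n. cinner (e j) (P *v e j))"
  proof (rule sum.cong[OF refl])
    fix j assume j: "j \<in> {..<n}"
    have "(\<Sum>i<n. cnj (u i j) * u i j) = (\<Sum>i<n. cinner (e j) (U *v e i) * cinner (U *v e i) (e j))"
    proof (rule sum.cong[OF refl])
      fix i assume "i \<in> {..<n}"
      then have "u i j = - u j i"
        using j by (intro u) auto
      then show "cnj (u i j) * u i j = cinner (e j) (U *v e i) * cinner (U *v e i) (e j)"
        by (simp only: u_def[symmetric] cnj_cinner[of "e j" "U *v e i", symmetric]) simp
    qed
    then show "(\<Sum>i<n. cnj (u i j) * u i j) = cinner (e j) (P *v e j)"
      by (simp add: sum_range_projection)
  qed
  also have "\<dots> = of_nat n"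
    by (simp add: cinner_P_basis)
  finally have uu: "(\<Sum>i<n. \<Sum>j<n. cnj (u i j) * u i j) = of_nat n" .
  have "(\<Sum>i<n. \<Sum>j<n. cinner (e i) (chi_map e U x y (B i j) *v e j)) =
    (\<Sum>i<n. \<Sum>j<n. (if i = j then of_nat n + 2 - of_real (x + y) else 0) - of_real (x + y) + of_real (x + y) * (cnj (u i j) * u i j))"
    using n_le
    by (intro sum.cong refl)
      (auto simp: cinner_chi_map trB eB gB g cinner_minus_left cinner_minus_right
        linear_neg[OF matrix_vector_mul_linear] cinner_basis algebra_simps)
  also have "\<dots> = of_nat n * (of_nat n + 2 - of_real (x + y)) - of_nat n * of_nat n * of_real (x + y) + of_real (x + y) * of_nat n"
    by (simp add: sum.distrib sum_subtractf sum_distrib_left[symmetric] uu del: of_real_add)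
      (simp add: algebra_simps)
  also have "\<dots> = of_real (real n * (real n + 2) - (x + y) * (real n)\<^sup>2)"
    by (simp add: algebra_simps power2_eq_square)
  finally show ?thesis .
qed

lemma indecomposable_chi_map:
  assumes "0 \<le> x" "x \<le> 1" "0 \<le> y" "y \<le> 1" and "0 < n" and "x + y > 1 + 2 / n"
  shows "indecomposable e (chi_map e U x y)"
proof -
  have "\<not> decomposable e (chi_map e U x y)"
  proof
    assume "decomposable e (chi_map e U x y)"
    then have "(x + y) * (real n)\<^sup>2 \<le> real n * (real n + 2)"
      using decomposable_pairing_nonneg[of "chi_map e U x y"]
      unfolding chi_map_pairing nonneg_Reals_of_real_iff by simp
    \<comment> \<open>Division by \<open>n\<^sup>2\<close> would bound \<open>x + y\<close> by the
      threshold that it exceeds by hypothesis.\<close>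
    also have "\<dots> = (1 + 2 / real n) * (real n)\<^sup>2"
      using \<open>0 < n\<close> by (simp add: field_simps power2_eq_square)
    finally show False
      using assms by simp
  qed
  then show ?thesis
    using assms by (simp add: indecomposable_def positive_map_def complex_linear_chi_map psd_chi_map)
qed

end

section \<open>From the subspace formulation to the first \<open>n\<close> basis vectors\<close>

theorem theorem6:
  fixes \<Sigma> :: "(complex ^ 'd) set"
    and e :: "nat \<Rightarrow> complex ^ 'd"
    and U :: "complex ^ 'd ^ 'd"
    and x y :: real
  assumes "CARD('d) \<ge> 4"
    and "vec.subspace \<Sigma>"
    and "even (vec.dim \<Sigma>)"
    and "vec.dim \<Sigma> \<ge> 4"
    and "orthonormal_basis e"
    and "\<Sigma> = vec.span (e ` {..<vec.dim \<Sigma>})"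
    and "unitary_on \<Sigma> U"
    and "zero_on_orthogonal_complement \<Sigma> U"
    and "transpose_wrt e U = - U"
    and "0 \<le> x" and "x \<le> 1" and "0 \<le> y" and "y \<le> 1"
    and "x + y > 3 / 2"
  shows "indecomposable e (chi_map e U x y)"
proof -
  define n where "n = vec.dim \<Sigma>"
  have n_le: "n \<le> CARD('d)"
    using vec.dim_subset_UNIV[of \<Sigma>] by (simp add: n_def vec.dimension_def card_cart_basis)
  have \<Sigma>: "\<Sigma> = vec.span (e ` {..<n})"
    using assms(6) by (simp add: n_def)
  interpret orthonormal_frame e
    by unfold_locales fact
  have mem: "e i \<in> \<Sigma>" if "i < n" for i
    unfolding \<Sigma> using that by (intro vec.span_base) auto
  \<comment> \<open>The basis vectors from index \<open>n\<close> on lie in the orthogonal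
    complement of \<open>\<Sigma>\<close>, so \<open>U\<close> annihilates them.\<close>
  have orth: "cinner w (e j) = 0" if "w \<in> \<Sigma>" and j: "n \<le> j" "j < CARD('d)" for w j
    using that(1) unfolding \<Sigma>
  proof (induction rule: vec.span_induct_alt)
    case (step c x y)
    then show ?case
      using j by (auto simp: cinner_add_left cinner_scale_left cinner_basis)
  qed simp
  interpret antisymmetric_partial_isometry e U n
  proof
    fix i j assume "i < n" "j < n"
    then show "cinner (U *v e i) (U *v e j) = (if i = j then 1 else 0)"
      using \<open>unitary_on \<Sigma> U\<close> mem n_le by (simp add: unitary_on_def cinner_basis)
  next
    fix j assume "n \<le> j" "j < CARD('d)"
    then show "U *v e j = 0"
      using \<open>zero_on_orthogonal_complement \<Sigma> U\<close> orth by (simp add: zero_on_orthogonal_complement_def)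
  qed (fact n_le assms(9))+
  \<comment> \<open>The threshold \<open>1 + 2 / n\<close> decreases in \<open>n\<close> and equals
    \<open>3 / 2\<close> at \<open>n = 4\<close>.\<close>
  have "2 / real n \<le> 2 / 4"
    using assms(4) by (intro divide_left_mono) (auto simp: n_def)
  then have "x + y > 1 + 2 / real n"
    using \<open>x + y > 3 / 2\<close> by simp
  then show ?thesis
    using assms by (intro indecomposable_chi_map) (auto simp: n_def)
qed

end
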